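(* Let $\alpha$ be a square-free positive rational number and let $\mathcal T_1=(T_1,\nu_1)$ and $\mathcal T_2=(T_2,\nu_2)$ be factorization trees for $\alpha$. Then $\nu_1(V(T_1))=\nu_2(V(T_2))$ if and only if $\mathcal T_1\cong\mathcal T_2$. In this case (where $\nu_2$ is injective), the map $\nu_2^{-1}\circ\nu_1:V(T_1)\to V(T_2)$ is an isomorphism.
   Context: Write $\alpha=a/b$ with $a,b$ coprime positive integers; $\alpha$ is square-free if $a$ and $b$ are both square-free. Let $p_1\ge\cdots\ge p_N$ be the primes dividing $ab$, listed with multiplicity. Put $\gamma(i)=1$ if $p_i\mid a$, $\gamma(i)=-1$ if $p_i\mid b$, and $\alpha_n=\prod_{i=1}^n p_i^{\gamma(i)}$ for $0\le n\le N$. A factorization of a positive rational $\beta$ is a sequence $(a_1/b_1,a_2/b_2,\dots)$ with $a_i,b_i$ positive integers, $a_i=b_i=1$ for all but finitely many $i$, $\prod_i a_i/b_i=\beta$, $\max\{a_i,b_i\}\ge\max\{a_{i+1},b_{i+1}\}$ for all $i$, and $\gcd(a_i,b_j)=1$ for all $i,j$. Let $\mathfrak F_\alpha$ be the set of factorizations of $\alpha_n$, $0\le n\le N$. For $0\le n<N$, a factorization $(a_i/b_i)$ of $\alpha_n$ is a direct subfactorization of a factorization $(c_i/d_i)$ of $\alpha_{n+1}$ if either $p_{n+1}\mid a$ and for some $k$: $d_i=b_i$ for all $i$, $c_i=a_i$ for $i\ne k$, $c_k=a_kp_{n+1}$; or $p_{n+1}\mid b$ and for some $k$: $c_i=a_i$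 for all $i$, $d_i=b_i$ for $i\ne k$, $d_k=b_kp_{n+1}$. A factorization tree for $\alpha$ is a pair $(T,\nu)$ with $T$ a rooted tree (digraph with edges from each vertex to its children) and $\nu:V(T)\to\mathfrak F_\alpha$, with parenting map $\phi$, such that: (1) the root $r_0$ has $\nu(r_0)=(1,1,\dots)$; (2) if $n<N$ and $\nu(r)$ is a factorization of $\alpha_n$ then $r$ has a child; (3) $\nu(r)=\nu(s)$ and $\phi(r)=\phi(s)$ imply $r=s$; (4) for non-root $r$, $\nu(\phi(r))$ is a direct subfactorization of $\nu(r)$. An isomorphism $(T_1,\nu_1)\to(T_2,\nu_2)$ is a bijection $\sigma:V(T_1)\to V(T_2)$ with $\nu_2\circ\sigma=\nu_1$ and $(g,h)\in E(T_1)\iff(\sigma(g),\sigma(h))\in E(T_2)$; $\cong$ means one exists. *)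

theory Defs
  imports
    Complex_Main
    "HOL-Computational_Algebra.Primes"
    "HOL-Computational_Algebra.Squarefree"
    "Graph_Theory.Pair_Digraph"
begin

text \<open>
  A positive rational \<open>\<alpha>\<close> is \<open>a/b\<close> with \<open>a = rat_num \<alpha>\<close> and \<open>b = rat_den \<alpha>\<close> coprime and positive.
\<close>

definition rat_num :: "rat \<Rightarrow> nat" where
  "rat_num \<alpha> = nat (fst (quotient_of \<alpha>))"

definition rat_den :: "rat \<Rightarrow> nat" where
  "rat_den \<alpha> = nat (snd (quotient_of \<alpha>))"

definition squarefree_rat :: "rat \<Rightarrow> bool" where
  "squarefree_rat \<alpha> \<longleftrightarrow> squarefree (rat_num \<alpha>) \<and> squarefree (rat_den \<alpha>)"

text \<open>
  The primes dividing \<open>a b\<close> in non-increasing order, with multiplicity. Lists are indexed from 0, so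
  \<open>p\<^sub>i\<close> of the mathematical text is \<open>prime_seq \<alpha> ! (i - 1)\<close>, and \<open>p\<^sub>n\<^sub>+\<^sub>1\<close> is \<open>prime_seq \<alpha> ! n\<close>.
\<close>

definition prime_seq :: "rat \<Rightarrow> nat list" where
  "prime_seq \<alpha> = rev (sorted_list_of_multiset (prime_factorization (rat_num \<alpha> * rat_den \<alpha>)))"

definition num_primes :: "rat \<Rightarrow> nat" where
  "num_primes \<alpha> = length (prime_seq \<alpha>)"

definition prime_sign :: "rat \<Rightarrow> nat \<Rightarrow> int" where
  "prime_sign \<alpha> i = (if prime_seq \<alpha> ! i dvd rat_num \<alpha> then 1 else - 1)"

definition partial_rat :: "rat \<Rightarrow> nat \<Rightarrow> rat" where
  "partial_rat \<alpha> n = (\<Prod>i<n. of_nat (prime_seq \<alpha> ! i) powi prime_sign \<alpha> i)"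

text \<open>
  The sequence \<open>(a\<^sub>i / b\<^sub>i)\<close> is represented by the sequence of pairs \<open>(a\<^sub>i, b\<^sub>i)\<close>, indexed from 0.
  The coprimality condition with \<open>i = j\<close> puts every \<open>a\<^sub>i / b\<^sub>i\<close> in lowest terms, so two factorizations
  agree as sequences of pairs iff they agree as sequences of rational numbers.
\<close>

type_synonym fraction_seq = "nat \<Rightarrow> nat \<times> nat"

definition is_factorization :: "rat \<Rightarrow> fraction_seq \<Rightarrow> bool" where
  "is_factorization \<beta> x \<longleftrightarrow>
     (\<forall>i. 0 < fst (x i) \<and> 0 < snd (x i)) \<and>
     finite {i. x i \<noteq> (1, 1)} \<and>
     (\<Prod>i | x i \<noteq> (1, 1). of_nat (fst (x i)) / of_nat (snd (x i))) = \<beta> \<and>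
     (\<forall>i. max (fst (x i)) (snd (x i)) \<ge> max (fst (x (Suc i))) (snd (x (Suc i)))) \<and>
     (\<forall>i j. coprime (fst (x i)) (snd (x j)))"

definition factorizations :: "rat \<Rightarrow> fraction_seq set" where
  "factorizations \<alpha> = {x. \<exists>n\<le>num_primes \<alpha>. is_factorization (partial_rat \<alpha> n) x}"

definition direct_subfactorization :: "rat \<Rightarrow> fraction_seq \<Rightarrow> fraction_seq \<Rightarrow> bool" where
  "direct_subfactorization \<alpha> x y \<longleftrightarrow>
     (\<exists>n<num_primes \<alpha>.
        is_factorization (partial_rat \<alpha> n) x \<and>
        is_factorization (partial_rat \<alpha> (Suc n)) y \<and>
        (prime_seq \<alpha> ! n dvd rat_num \<alpha> \<and>
           (\<exists>k. (\<forall>i. snd (y i) = snd (x i)) \<and>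
                (\<forall>i. i \<noteq> k \<longrightarrow> fst (y i) = fst (x i)) \<and>
                fst (y k) = fst (x k) * prime_seq \<alpha> ! n)
         \<or>
         prime_seq \<alpha> ! n dvd rat_den \<alpha> \<and>
           (\<exists>k. (\<forall>i. fst (y i) = fst (x i)) \<and>
                (\<forall>i. i \<noteq> k \<longrightarrow> snd (y i) = snd (x i)) \<and>
                snd (y k) = snd (x k) * prime_seq \<alpha> ! n)))"

text \<open>
  A rooted tree whose edges point away from the root. Uniqueness of the walk from the root to itself
  excludes edges into the root and directed cycles.
\<close>

locale rooted_tree = pair_wf_digraph T for T :: "'v pair_pre_digraph" +
  fixes root :: 'v
  assumes root_in_verts: "root \<in> pverts T"
    and unique_awalk: "v \<in> pverts T \<Longrightarrow> \<exists>!p. awalk root p v"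

text \<open>The parenting map; it is meaningful only at non-root vertices.\<close>

definition parent :: "'v pair_pre_digraph \<Rightarrow> 'v \<Rightarrow> 'v" where
  "parent T v = (THE u. (u, v) \<in> parcs T)"

locale factorization_tree = rooted_tree T root
  for \<alpha> :: rat and T :: "'v pair_pre_digraph" and root :: 'v +
  fixes \<nu> :: "'v \<Rightarrow> fraction_seq"
  assumes label_in: "r \<in> pverts T \<Longrightarrow> \<nu> r \<in> factorizations \<alpha>"
    and label_root: "\<nu> root = (\<lambda>_. (1, 1))"
    and has_child:
      "\<lbrakk>r \<in> pverts T; n < num_primes \<alpha>; is_factorization (partial_rat \<alpha> n) (\<nu> r)\<rbrakk>
         \<Longrightarrow> \<exists>s. (r, s) \<in> parcs T"
    and siblings_distinct:
      "\<lbrakk>r \<in> pverts T - {root}; s \<in> pverts T - {root}; \<nu> r = \<nu> s; parent T r = parent T s\<rbrakk>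
         \<Longrightarrow> r = s"
    and parent_label:
      "r \<in> pverts T - {root} \<Longrightarrow> direct_subfactorization \<alpha> (\<nu> (parent T r)) (\<nu> r)"

definition tree_isomorphism ::
    "'v pair_pre_digraph \<Rightarrow> ('v \<Rightarrow> fraction_seq) \<Rightarrow> 'w pair_pre_digraph \<Rightarrow> ('w \<Rightarrow> fraction_seq)
       \<Rightarrow> ('v \<Rightarrow> 'w) \<Rightarrow> bool" where
  "tree_isomorphism T\<^sub>1 \<nu>\<^sub>1 T\<^sub>2 \<nu>\<^sub>2 \<sigma> \<longleftrightarrow>
     bij_betw \<sigma> (pverts T\<^sub>1) (pverts T\<^sub>2) \<and>
     (\<forall>g\<in>pverts T\<^sub>1. \<nu>\<^sub>2 (\<sigma> g) = \<nu>\<^sub>1 g) \<and>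
     (\<forall>g\<in>pverts T\<^sub>1. \<forall>h\<in>pverts T\<^sub>1. (g, h) \<in> parcs T\<^sub>1 \<longleftrightarrow> (\<sigma> g, \<sigma> h) \<in> parcs T\<^sub>2)"

definition tree_isomorphic ::
    "'v pair_pre_digraph \<Rightarrow> ('v \<Rightarrow> fraction_seq) \<Rightarrow> 'w pair_pre_digraph \<Rightarrow> ('w \<Rightarrow> fraction_seq)
       \<Rightarrow> bool" where
  "tree_isomorphic T\<^sub>1 \<nu>\<^sub>1 T\<^sub>2 \<nu>\<^sub>2 \<longleftrightarrow> (\<exists>\<sigma>. tree_isomorphism T\<^sub>1 \<nu>\<^sub>1 T\<^sub>2 \<nu>\<^sub>2 \<sigma>)"

end

theory Submission
  imports Defs
begin

text \<open>
  Squarefreeness makes \<open>p\<^sub>1 > \<dots> > p\<^sub>N\<close> distinct, so \<open>p\<^sub>n\<^sub>+\<^sub>1\<close> divides no entry of a factorization of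
  \<open>\<alpha>\<^sub>n\<close>. Hence a factorization of \<open>\<alpha>\<^sub>n\<^sub>+\<^sub>1\<close> has at most one direct subfactorization, obtained by
  removing \<open>p\<^sub>n\<^sub>+\<^sub>1\<close> from the unique entry which it divides. By induction on \<open>n\<close>, the label of a vertex
  then determines the vertex, and the arcs of a factorization tree are exactly the pairs of vertices
  whose labels are related by direct subfactorization. So the set of labels determines the tree.
\<close>

section \<open>Factorizations of quotients\<close>

text \<open>Cross-multiplying moves the rational identity into the natural numbers, where
  divisibility by primes can be used.\<close>

lemma is_factorization_cross:
  assumes "is_factorization (of_nat A / of_nat B) x" and "0 < B"
  shows "B * (\<Prod>i | x i \<noteq> (1, 1). fst (x i)) = A * (\<Prod>i | x i \<noteq> (1, 1). snd (x i))"
proof -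
  let ?S = "{i. x i \<noteq> (1, 1)}"
  let ?P = "\<Prod>i\<in>?S. fst (x i)" and ?Q = "\<Prod>i\<in>?S. snd (x i)"
  have pos: "\<And>i. 0 < snd (x i)"
    and eq: "(\<Prod>i\<in>?S. of_nat (fst (x i)) / of_nat (snd (x i))) = (of_nat A / of_nat B :: rat)"
    using assms(1) by (auto simp: is_factorization_def)
  have "0 < ?Q"
    using pos by (simp add: prod_pos)
  moreover have "of_nat ?P / of_nat ?Q = (of_nat A / of_nat B :: rat)"
    using eq by (simp add: prod_dividef)
  ultimately have "(of_nat ?P * of_nat B :: rat) = of_nat A * of_nat ?Q"
    using \<open>0 < B\<close> by (simp only: frac_eq_eq of_nat_eq_0_iff neq0_conv)
  then have "?P * B = A * ?Q"
    by (simp only: flip: of_nat_mult of_nat_eq_iff)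
  then show ?thesis
    by (simp add: mult.commute)
qed

text \<open>If \<open>p\<close> divides a first entry but not \<open>A\<close>, the cross identity
  forces it to divide some second entry. Entries are coprime even across different indices, so this
  is impossible.\<close>

lemma is_factorization_prime_not_dvd_fst:
  assumes x: "is_factorization (of_nat A / of_nat B) x" and "0 < B"
    and p: "prime p" and "\<not> p dvd A"
  shows "\<not> p dvd fst (x k)"
proof
  assume dvd: "p dvd fst (x k)"
  let ?S = "{i. x i \<noteq> (1, 1)}"
  have fin: "finite ?S" and cop: "\<And>i j. coprime (fst (x i)) (snd (x j))"
    using x by (auto simp: is_factorization_def)
  \<comment> \<open>Off the support the entry is 1, which no prime divides.\<close>
  have "k \<in> ?S"
    using dvd p not_prime_unit by fastforce
  with fin have "fst (x k) dvd (\<Prod>i\<in>?S. fst (x i))"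
    by (rule dvd_prodI)
  with dvd have "p dvd A * (\<Prod>i\<in>?S. snd (x i))"
    unfolding is_factorization_cross[OF x \<open>0 < B\<close>, symmetric] by (meson dvd_mult dvd_trans)
  with \<open>\<not> p dvd A\<close> p have "p dvd (\<Prod>i\<in>?S. snd (x i))"
    by (simp add: prime_dvd_mult_iff)
  then obtain j where "p dvd snd (x j)"
    using p fin by (auto simp: prime_dvd_prod_iff)
  with dvd cop p show False
    by (metis coprime_common_divisor not_prime_unit)
qed

text \<open>Mirror image of the previous argument, with the two sides of the cross identity
  exchanged.\<close>

lemma is_factorization_prime_not_dvd_snd:
  assumes x: "is_factorization (of_nat A / of_nat B) x" and "0 < B"
    and p: "prime p" and "\<not> p dvd B"
  shows "\<not> p dvd snd (x k)"
proof
  assume dvd: "p dvd snd (x k)"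
  let ?S = "{i. x i \<noteq> (1, 1)}"
  have fin: "finite ?S" and cop: "\<And>i j. coprime (fst (x i)) (snd (x j))"
    using x by (auto simp: is_factorization_def)
  have "k \<in> ?S"
    using dvd p not_prime_unit by fastforce
  with fin have "snd (x k) dvd (\<Prod>i\<in>?S. snd (x i))"
    by (rule dvd_prodI)
  with dvd have "p dvd B * (\<Prod>i\<in>?S. fst (x i))"
    unfolding is_factorization_cross[OF x \<open>0 < B\<close>] by (meson dvd_mult dvd_trans)
  with \<open>\<not> p dvd B\<close> p have "p dvd (\<Prod>i\<in>?S. fst (x i))"
    by (simp add: prime_dvd_mult_iff)
  then obtain j where "p dvd fst (x j)"
    using p fin by (auto simp: prime_dvd_prod_iff)
  with dvd cop p show False
    by (metis coprime_common_divisor not_prime_unit)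
qed

section \<open>The partial products of a square-free rational\<close>

text \<open>With \<open>partial_den\<close>, this splits the signed product
  \<open>partial_rat\<close> into two natural numbers. The test is that of
  \<open>prime_sign\<close>, so a prime missing \<open>rat_num\<close> counts towards the
  denominator.\<close>

definition partial_num :: "rat \<Rightarrow> nat \<Rightarrow> nat" where
  "partial_num \<alpha> n =
     (\<Prod>i<n. if prime_seq \<alpha> ! i dvd rat_num \<alpha> then prime_seq \<alpha> ! i else 1)"

definition partial_den :: "rat \<Rightarrow> nat \<Rightarrow> nat" where
  "partial_den \<alpha> n =
     (\<Prod>i<n. if prime_seq \<alpha> ! i dvd rat_num \<alpha> then 1 else prime_seq \<alpha> ! i)"

lemma partial_rat_eq: "partial_rat \<alpha> n = of_nat (partial_num \<alpha> n) / of_nat (partial_den \<alpha> n)"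
  unfolding partial_rat_def partial_num_def partial_den_def of_nat_prod prod_dividef[symmetric]
  by (rule prod.cong) (auto simp: prime_sign_def power_int_minus field_simps)

lemma prime_prime_seq: "i < num_primes \<alpha> \<Longrightarrow> prime (prime_seq \<alpha> ! i)"
proof -
  assume "i < num_primes \<alpha>"
  then have "prime_seq \<alpha> ! i \<in> set (prime_seq \<alpha>)"
    by (simp add: num_primes_def)
  then show ?thesis
    by (auto simp: prime_seq_def)
qed

text \<open>Positivity keeps \<open>nat\<close> from truncating the numerator, so coprimality
  carries over from the integers.\<close>

lemma coprime_rat_num_den: "0 < \<alpha> \<Longrightarrow> coprime (rat_num \<alpha>) (rat_den \<alpha>)"
proof -
  assume "0 < \<alpha>"
  obtain a b where ab: "quotient_of \<alpha> = (a, b)"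
    by (cases "quotient_of \<alpha>")
  then have "coprime a b" "0 < b" "\<alpha> = of_int a / of_int b"
    by (auto intro: quotient_of_coprime quotient_of_denom_pos quotient_of_div)
  moreover from this \<open>0 < \<alpha>\<close> have "0 < a"
    by (simp add: zero_less_divide_iff)
  ultimately show ?thesis
    unfolding rat_num_def rat_den_def ab by (simp flip: coprime_int_iff)
qed

context
  fixes \<alpha> :: rat
  assumes pos: "0 < \<alpha>" and sqf: "squarefree_rat \<alpha>"
begin

text \<open>Numerator and denominator are squarefree and coprime, so their product is squarefree and
  each of its prime factors has multiplicity one.\<close>

lemma distinct_prime_seq: "distinct (prime_seq \<alpha>)"
proof -
  have "squarefree (rat_num \<alpha> * rat_den \<alpha>)"
    using sqf coprime_rat_num_den[OF pos] by (simp add: squarefree_rat_def squarefree_mult_coprime)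
  then have "\<not> 2 \<le> multiplicity p (rat_num \<alpha> * rat_den \<alpha>)" if "prime p" for p
    using that multiplicity_dvd'[of 2 p] squarefreeD[of _ p] not_prime_unit[of p] by blast
  then have "multiplicity p (rat_num \<alpha> * rat_den \<alpha>) \<le> 1" if "prime p" for p
    using that by (simp only: not_le) (simp only: numeral_2_eq_2 less_Suc_eq_le One_nat_def)
  then have "count (prime_factorization (rat_num \<alpha> * rat_den \<alpha>)) p \<le> 1" for p
    by (simp add: count_prime_factorization)
  \<comment> \<open>A multiset with all counts at most 1 comes from its support, and the sorted list
    of a finite set has no repetitions.\<close>
  then have "mset_set (set_mset (prime_factorization (rat_num \<alpha> * rat_den \<alpha>)))
      = prime_factorization (rat_num \<alpha> * rat_den \<alpha>)"
    by (intro multiset_eqI) (simp add: count_mset_set' le_antisym count_eq_zero_iff Suc_leI)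
  then show ?thesis
    by (metis distinct_rev distinct_sorted_list_of_set prime_seq_def
        sorted_list_of_mset_set)
qed

text \<open>A prime divides a product of primes only by equalling a factor, and by distinctness that
  factor has index \<open>i\<close>.\<close>

lemma prime_seq_dvd_partial_num_iff:
  assumes "i < num_primes \<alpha>" and "n \<le> num_primes \<alpha>"
  shows "prime_seq \<alpha> ! i dvd partial_num \<alpha> n \<longleftrightarrow> i < n \<and> prime_seq \<alpha> ! i dvd rat_num \<alpha>"
proof
  assume "prime_seq \<alpha> ! i dvd partial_num \<alpha> n"
  then obtain j where j: "j < n" "prime_seq \<alpha> ! j dvd rat_num \<alpha>"
      "prime_seq \<alpha> ! i dvd prime_seq \<alpha> ! j"
    using prime_prime_seq[OF assms(1)]
    by (auto simp: partial_num_def prime_dvd_prod_iff split: if_splits)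
  then have "i = j"
    using assms distinct_prime_seq prime_prime_seq
    by (metis nth_eq_iff_index_eq num_primes_def order_less_le_trans primes_dvd_imp_eq)
  with j show "i < n \<and> prime_seq \<alpha> ! i dvd rat_num \<alpha>"
    by simp
next
  assume "i < n \<and> prime_seq \<alpha> ! i dvd rat_num \<alpha>"
  then show "prime_seq \<alpha> ! i dvd partial_num \<alpha> n"
    using prime_prime_seq[OF assms(1)] by (auto simp: partial_num_def prime_dvd_prod_iff intro!: bexI[of _ i])
qed

lemma prime_seq_dvd_partial_den_iff:
  assumes "i < num_primes \<alpha>" and "n \<le> num_primes \<alpha>"
  shows "prime_seq \<alpha> ! i dvd partial_den \<alpha> n \<longleftrightarrow> i < n \<and> \<not> prime_seq \<alpha> ! i dvd rat_num \<alpha>"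
proof
  assume "prime_seq \<alpha> ! i dvd partial_den \<alpha> n"
  then obtain j where j: "j < n" "\<not> prime_seq \<alpha> ! j dvd rat_num \<alpha>"
      "prime_seq \<alpha> ! i dvd prime_seq \<alpha> ! j"
    using prime_prime_seq[OF assms(1)]
    by (auto simp: partial_den_def prime_dvd_prod_iff split: if_splits)
  then have "i = j"
    using assms distinct_prime_seq prime_prime_seq
    by (metis nth_eq_iff_index_eq num_primes_def order_less_le_trans primes_dvd_imp_eq)
  with j show "i < n \<and> \<not> prime_seq \<alpha> ! i dvd rat_num \<alpha>"
    by simp
next
  assume "i < n \<and> \<not> prime_seq \<alpha> ! i dvd rat_num \<alpha>"
  then show "prime_seq \<alpha> ! i dvd partial_den \<alpha> n"
    using prime_prime_seq[OF assms(1)] by (auto simp: partial_den_def prime_dvd_prod_iff intro!: bexI[of _ i])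
qed

lemma partial_den_pos: "n \<le> num_primes \<alpha> \<Longrightarrow> 0 < partial_den \<alpha> n"
  by (auto simp: partial_den_def intro!: prod_pos prime_gt_0_nat prime_prime_seq)

text \<open>The prime at index \<open>n\<close> is absent at stage \<open>n\<close>; at stage
  \<open>m\<close> it divides exactly one of numerator and denominator. After cross-multiplication
  it therefore divides exactly one side.\<close>

lemma partial_rat_neq:
  assumes "n < m" and "m \<le> num_primes \<alpha>"
  shows "partial_rat \<alpha> n \<noteq> partial_rat \<alpha> m"
proof
  assume "partial_rat \<alpha> n = partial_rat \<alpha> m"
  then have "(of_nat (partial_num \<alpha> n) * of_nat (partial_den \<alpha> m) :: rat)
      = of_nat (partial_num \<alpha> m) * of_nat (partial_den \<alpha> n)"
    using partial_den_pos[of n] partial_den_pos[of m] assms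
    by (simp add: partial_rat_eq frac_eq_eq)
  then have "partial_num \<alpha> n * partial_den \<alpha> m = partial_num \<alpha> m * partial_den \<alpha> n"
    by (simp only: flip: of_nat_mult of_nat_eq_iff)
  then have "prime_seq \<alpha> ! n dvd partial_num \<alpha> n * partial_den \<alpha> m
      \<longleftrightarrow> prime_seq \<alpha> ! n dvd partial_num \<alpha> m * partial_den \<alpha> n"
    by simp
  then show False
    using assms prime_prime_seq[of n \<alpha>]
    by (simp add: prime_dvd_mult_iff prime_seq_dvd_partial_num_iff prime_seq_dvd_partial_den_iff)
qed

text \<open>The entries determine the product, and products at different stages differ. Thus a
  factorization has a well-defined level, which identifies the index hidden in
  \<open>direct_subfactorization\<close>.\<close>

lemma is_factorization_level_unique:
  assumes "is_factorization (partial_rat \<alpha> n) x" and "is_factorization (partial_rat \<alpha> m) x"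
    and "n \<le> num_primes \<alpha>" and "m \<le> num_primes \<alpha>"
  shows "n = m"
proof -
  have "partial_rat \<alpha> n = partial_rat \<alpha> m"
    using assms(1,2) by (auto simp: is_factorization_def)
  then show ?thesis
    using assms(3,4) partial_rat_neq by (metis linorder_neqE_nat)
qed

text \<open>Indices start at 0, so \<open>prime_seq \<alpha> ! n\<close> is the prime adjoined
  between stages \<open>n\<close> and \<open>n + 1\<close>; it divides neither part of stage
  \<open>n\<close>.\<close>

lemma prime_seq_not_dvd_factorization:
  assumes "is_factorization (partial_rat \<alpha> n) x" and "n < num_primes \<alpha>"
  shows "\<not> prime_seq \<alpha> ! n dvd fst (x k)" and "\<not> prime_seq \<alpha> ! n dvd snd (x k)"
proof -
  have x: "is_factorization (of_nat (partial_num \<alpha> n) / of_nat (partial_den \<alpha> n)) x"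
    using assms(1) by (simp add: partial_rat_eq)
  show "\<not> prime_seq \<alpha> ! n dvd fst (x k)"
    using is_factorization_prime_not_dvd_fst[OF x] assms(2)
    by (simp add: partial_den_pos prime_prime_seq prime_seq_dvd_partial_num_iff)
  show "\<not> prime_seq \<alpha> ! n dvd snd (x k)"
    using is_factorization_prime_not_dvd_snd[OF x] assms(2)
    by (simp add: partial_den_pos prime_prime_seq prime_seq_dvd_partial_den_iff)
qed

lemma direct_subfactorization_unique:
  assumes "direct_subfactorization \<alpha> x z" and "direct_subfactorization \<alpha> y z"
  shows "x = y"
proof -
  let ?p = "\<lambda>n. prime_seq \<alpha> ! n"
  obtain n where n: "n < num_primes \<alpha>"
    and x: "is_factorization (partial_rat \<alpha> n) x"
    and zn: "is_factorization (partial_rat \<alpha> (Suc n)) z"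
    and xz: "?p n dvd rat_num \<alpha> \<and> (\<exists>k. (\<forall>i. snd (z i) = snd (x i)) \<and>
        (\<forall>i. i \<noteq> k \<longrightarrow> fst (z i) = fst (x i)) \<and> fst (z k) = fst (x k) * ?p n) \<or>
      ?p n dvd rat_den \<alpha> \<and> (\<exists>k. (\<forall>i. fst (z i) = fst (x i)) \<and>
        (\<forall>i. i \<noteq> k \<longrightarrow> snd (z i) = snd (x i)) \<and> snd (z k) = snd (x k) * ?p n)"
    using assms(1) unfolding direct_subfactorization_def by blast
  obtain m where m: "m < num_primes \<alpha>"
    and y: "is_factorization (partial_rat \<alpha> m) y"
    and zm: "is_factorization (partial_rat \<alpha> (Suc m)) z"
    and yz: "?p m dvd rat_num \<alpha> \<and> (\<exists>k. (\<forall>i. snd (z i) = snd (y i)) \<and>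
        (\<forall>i. i \<noteq> k \<longrightarrow> fst (z i) = fst (y i)) \<and> fst (z k) = fst (y k) * ?p m) \<or>
      ?p m dvd rat_den \<alpha> \<and> (\<exists>k. (\<forall>i. fst (z i) = fst (y i)) \<and>
        (\<forall>i. i \<noteq> k \<longrightarrow> snd (z i) = snd (y i)) \<and> snd (z k) = snd (y k) * ?p m)"
    using assms(2) unfolding direct_subfactorization_def by blast
  have "m = n"
    using is_factorization_level_unique[OF zn zm] n m by simp
  have p: "prime (?p n)"
    using n by (rule prime_prime_seq)
  have not_both: "\<not> (?p n dvd rat_num \<alpha> \<and> ?p n dvd rat_den \<alpha>)"
    using coprime_rat_num_den[OF pos] p by (metis coprime_common_divisor not_prime_unit)
  note ndvd = prime_seq_not_dvd_factorization[OF x n]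
    prime_seq_not_dvd_factorization[OF y[unfolded \<open>m = n\<close>] n]
  show ?thesis
  proof (cases "?p n dvd rat_num \<alpha>")
    case True
    with xz not_both obtain k where k: "\<And>i. snd (z i) = snd (x i)"
        "\<And>i. i \<noteq> k \<Longrightarrow> fst (z i) = fst (x i)" "fst (z k) = fst (x k) * ?p n"
      by blast
    from True yz not_both \<open>m = n\<close> obtain l where l: "\<And>i. snd (z i) = snd (y i)"
        "\<And>i. i \<noteq> l \<Longrightarrow> fst (z i) = fst (y i)" "fst (z l) = fst (y l) * ?p n"
      by blast
    \<comment> \<open>Otherwise entry \<open>k\<close> of \<open>z\<close> would be both a multiple
      of the new prime and the unchanged entry of \<open>y\<close>, contradicting
      \<open>ndvd\<close>.\<close>
    have "k = l"
      using k l ndvd by (metis dvd_triv_right)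
    \<comment> \<open>Away from \<open>k\<close> both agree with \<open>z\<close>; at
      \<open>k\<close> the nonzero prime cancels.\<close>
    have "fst (x i) = fst (y i)" for i
      using k l p \<open>k = l\<close> by (metis mult_right_cancel not_prime_0)
    with k(1) l(1) show ?thesis
      by (simp add: fun_eq_iff prod_eq_iff)
  next
    case False
    with xz obtain k where k: "\<And>i. fst (z i) = fst (x i)"
        "\<And>i. i \<noteq> k \<Longrightarrow> snd (z i) = snd (x i)" "snd (z k) = snd (x k) * ?p n"
      by blast
    from False yz \<open>m = n\<close> obtain l where l: "\<And>i. fst (z i) = fst (y i)"
        "\<And>i. i \<noteq> l \<Longrightarrow> snd (z i) = snd (y i)" "snd (z l) = snd (y l) * ?p n"
      by blast
    have "k = l"
      using k l ndvd by (metis dvd_triv_right)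
    have "snd (x i) = snd (y i)" for i
      using k l p \<open>k = l\<close> by (metis mult_right_cancel not_prime_0)
    with k(1) l(1) show ?thesis
      by (simp add: fun_eq_iff prod_eq_iff)
  qed
qed

end

section \<open>Factorization trees\<close>

context rooted_tree
begin

lemma awalk_snoc:
  assumes "awalk root p u" and "(u, v) \<in> parcs T"
  shows "awalk root (p @ [(u, v)]) v"
  using assms arc_implies_awalk[of "(u, v)"] by (intro awalk_appendI) auto

text \<open>An arc into the root would close a nonempty walk from the root to itself, besides the
  empty one.\<close>

lemma arc_not_root: "(u, v) \<in> parcs T \<Longrightarrow> v \<noteq> root"
proof
  assume uv: "(u, v) \<in> parcs T" and "v = root"
  then obtain p where "awalk root p u"
    using unique_awalk[OF in_arcsD1[OF uv]] by blast
  from awalk_snoc[OF this uv] have "awalk root (p @ [(u, v)]) root"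
    using \<open>v = root\<close> by simp
  moreover have "awalk root [] root"
    using root_in_verts by (simp add: awalk_Nil_iff)
  ultimately show False
    using unique_awalk[OF root_in_verts] by blast
qed

text \<open>Two arcs into \<open>v\<close> would give two walks from the root with different last
  arcs, so the description defining \<open>parent\<close> has a unique solution.\<close>

lemma parent_eqI:
  assumes uv: "(u, v) \<in> parcs T"
  shows "parent T v = u"
  unfolding parent_def
proof (rule the_equality, rule uv)
  fix w
  assume wv: "(w, v) \<in> parcs T"
  obtain p q where "awalk root p u" "awalk root q w"
    using unique_awalk[OF in_arcsD1[OF uv]] unique_awalk[OF in_arcsD1[OF wv]] by blast
  then have "awalk root (p @ [(u, v)]) v" "awalk root (q @ [(w, v)]) v"
    using uv wv by (blast intro: awalk_snoc)+
  moreover have "v \<in> pverts T"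
    using uv in_arcsD2 by blast
  ultimately have "p @ [(u, v)] = q @ [(w, v)]"
    using unique_awalk by blast
  then show "w = u"
    by simp
qed

lemma parent_arc:
  assumes "v \<in> pverts T" and "v \<noteq> root"
  shows "(parent T v, v) \<in> parcs T"
proof -
  obtain p where p: "awalk root p v"
    using unique_awalk assms(1) by blast
  with \<open>v \<noteq> root\<close> have "p \<noteq> []"
    by (auto simp: awalk_Nil_iff)
  then obtain q e where "p = q @ [e]"
    by (metis rev_exhaust)
  with p have "e \<in> parcs T" "snd e = v"
    by (auto simp: awalk_append_iff awalk_Cons_iff awalk_Nil_iff)
  then have "(fst e, v) \<in> parcs T"
    by (cases e) auto
  then show ?thesis
    by (simp add: parent_eqI)
qed

end

section \<open>Recovering vertices and arcs from labels\<close>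

context factorization_tree
begin

lemma nonroot_level:
  assumes "r \<in> pverts T" and "r \<noteq> root"
  obtains n where "n < num_primes \<alpha>" "is_factorization (partial_rat \<alpha> n) (\<nu> (parent T r))"
    "is_factorization (partial_rat \<alpha> (Suc n)) (\<nu> r)"
  using parent_label[of r] assms unfolding direct_subfactorization_def by blast

lemma root_level: "is_factorization (partial_rat \<alpha> 0) (\<nu> root)"
  by (simp add: label_root is_factorization_def partial_rat_def)

context
  assumes pos: "0 < \<alpha>" and sqf: "squarefree_rat \<alpha>"
begin

lemma level_eq_0_imp_root:
  assumes "r \<in> pverts T" and "is_factorization (partial_rat \<alpha> 0) (\<nu> r)"
  shows "r = root"
proof (rule ccontr)
  assume "r \<noteq> root"
  with assms(1) obtain n where "n < num_primes \<alpha>" "is_factorization (partial_rat \<alpha> (Suc n)) (\<nu> r)"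
    by (rule nonroot_level)
  then show False
    using is_factorization_level_unique[OF pos sqf assms(2)] by fastforce
qed

text \<open>Induction on the level: equal labels have the same direct subfactorization, so the
  parents share a label one level lower and coincide. Siblings with equal labels are equal.\<close>

lemma label_eq_imp_eq:
  assumes "n \<le> num_primes \<alpha>" and "r \<in> pverts T" and "s \<in> pverts T" and "\<nu> r = \<nu> s"
    and "is_factorization (partial_rat \<alpha> n) (\<nu> r)"
  shows "r = s"
  using assms
proof (induction n arbitrary: r s)
  case 0
  then show ?case
    using level_eq_0_imp_root by metis
next
  case (Suc n)
  \<comment> \<open>The root has level 0, so neither vertex is the root and both have
    parents.\<close>
  have "\<not> is_factorization (partial_rat \<alpha> 0) (\<nu> r)"
    using is_factorization_level_unique[OF pos sqf Suc.prems(5)] Suc.prems(1) by fastforce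
  then have r: "r \<noteq> root" and s: "s \<noteq> root"
    using root_level Suc.prems(4) by metis+
  have "direct_subfactorization \<alpha> (\<nu> (parent T r)) (\<nu> r)"
    "direct_subfactorization \<alpha> (\<nu> (parent T s)) (\<nu> r)"
    using parent_label[of r] parent_label[of s] r s Suc.prems(2-4) by auto
  then have labels: "\<nu> (parent T r) = \<nu> (parent T s)"
    by (rule direct_subfactorization_unique[OF pos sqf])
  obtain m where "m < num_primes \<alpha>" "is_factorization (partial_rat \<alpha> m) (\<nu> (parent T r))"
    "is_factorization (partial_rat \<alpha> (Suc m)) (\<nu> r)"
    using nonroot_level[OF Suc.prems(2) r] .
  \<comment> \<open>Uniqueness of the level of \<open>\<nu> r\<close> gives
    \<open>m = n\<close>.\<close>
  then have "is_factorization (partial_rat \<alpha> n) (\<nu> (parent T r))"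
    using is_factorization_level_unique[OF pos sqf Suc.prems(5)] Suc.prems(1) by fastforce
  moreover have "parent T r \<in> pverts T" "parent T s \<in> pverts T"
    using parent_arc Suc.prems(2,3) r s in_arcsD1 by blast+
  ultimately have "parent T r = parent T s"
    using Suc.IH Suc.prems(1) labels by simp
  then show ?case
    using siblings_distinct[of r s] Suc.prems r s by simp
qed

lemma inj_on_label: "inj_on \<nu> (pverts T)"
proof (rule inj_onI)
  fix r s
  assume r: "r \<in> pverts T" and s: "s \<in> pverts T" and "\<nu> r = \<nu> s"
  moreover obtain n where "n \<le> num_primes \<alpha>" "is_factorization (partial_rat \<alpha> n) (\<nu> r)"
    using label_in[OF r] by (auto simp: factorizations_def)
  ultimately show "r = s"
    by (intro label_eq_imp_eq)
qed

text \<open>For the converse, \<open>\<nu> g\<close> and the label of the parent of \<open>h\<close>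
  are both direct subfactorizations of \<open>\<nu> h\<close>, hence equal; injectivity of \<nu>
  makes \<open>g\<close> that parent.\<close>

lemma arc_iff_direct_subfactorization:
  assumes "g \<in> pverts T" and "h \<in> pverts T"
  shows "(g, h) \<in> parcs T \<longleftrightarrow> direct_subfactorization \<alpha> (\<nu> g) (\<nu> h)"
proof
  assume "(g, h) \<in> parcs T"
  then show "direct_subfactorization \<alpha> (\<nu> g) (\<nu> h)"
    using parent_label[of h] arc_not_root parent_eqI assms by auto
next
  assume sub: "direct_subfactorization \<alpha> (\<nu> g) (\<nu> h)"
  then obtain n where "n < num_primes \<alpha>" "is_factorization (partial_rat \<alpha> (Suc n)) (\<nu> h)"
    by (auto simp: direct_subfactorization_def)
  then have "h \<noteq> root"
    using is_factorization_level_unique[OF pos sqf root_level] by fastforce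
  with assms(2) have arc: "(parent T h, h) \<in> parcs T"
    by (rule parent_arc)
  have "\<nu> (parent T h) = \<nu> g"
    using direct_subfactorization_unique[OF pos sqf _ sub] parent_label[of h] assms(2) \<open>h \<noteq> root\<close>
    by simp
  then have "parent T h = g"
    using inj_onD[OF inj_on_label] arc assms(1) in_arcsD1 by blast
  with arc show "(g, h) \<in> parcs T"
    by simp
qed

end

end

section \<open>Comparing two trees through their labels\<close>

theorem theorem3p3:
  fixes \<alpha> :: rat
    and T\<^sub>1 :: "'v pair_pre_digraph" and r\<^sub>1 :: 'v and \<nu>\<^sub>1 :: "'v \<Rightarrow> fraction_seq"
    and T\<^sub>2 :: "'w pair_pre_digraph" and r\<^sub>2 :: 'w and \<nu>\<^sub>2 :: "'w \<Rightarrow> fraction_seq"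
  assumes "0 < \<alpha>" and "squarefree_rat \<alpha>"
    and "factorization_tree \<alpha> T\<^sub>1 r\<^sub>1 \<nu>\<^sub>1"
    and "factorization_tree \<alpha> T\<^sub>2 r\<^sub>2 \<nu>\<^sub>2"
  shows "(\<nu>\<^sub>1 ` pverts T\<^sub>1 = \<nu>\<^sub>2 ` pverts T\<^sub>2 \<longleftrightarrow> tree_isomorphic T\<^sub>1 \<nu>\<^sub>1 T\<^sub>2 \<nu>\<^sub>2) \<and>
    (\<nu>\<^sub>1 ` pverts T\<^sub>1 = \<nu>\<^sub>2 ` pverts T\<^sub>2 \<longrightarrow>
       inj_on \<nu>\<^sub>2 (pverts T\<^sub>2) \<and>
       tree_isomorphism T\<^sub>1 \<nu>\<^sub>1 T\<^sub>2 \<nu>\<^sub>2 (inv_into (pverts T\<^sub>2) \<nu>\<^sub>2 \<circ> \<nu>\<^sub>1))"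
proof -
  interpret A: factorization_tree \<alpha> T\<^sub>1 r\<^sub>1 \<nu>\<^sub>1 by fact
  interpret B: factorization_tree \<alpha> T\<^sub>2 r\<^sub>2 \<nu>\<^sub>2 by fact
  let ?\<sigma> = "inv_into (pverts T\<^sub>2) \<nu>\<^sub>2 \<circ> \<nu>\<^sub>1"
  note inj1 = A.inj_on_label[OF assms(1,2)] and inj2 = B.inj_on_label[OF assms(1,2)]
  have iso: "tree_isomorphism T\<^sub>1 \<nu>\<^sub>1 T\<^sub>2 \<nu>\<^sub>2 ?\<sigma>" if eq: "\<nu>\<^sub>1 ` pverts T\<^sub>1 = \<nu>\<^sub>2 ` pverts T\<^sub>2"
  proof -
    have bij: "bij_betw ?\<sigma> (pverts T\<^sub>1) (pverts T\<^sub>2)"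
      using inj1 inj2 eq by (metis bij_betw_inv_into bij_betw_trans inj_on_imp_bij_betw)
    \<comment> \<open>Equality of the images puts \<open>\<nu>\<^sub>1 g\<close> in the range of
      \<open>\<nu>\<^sub>2\<close>, so \<open>inv_into\<close> returns a genuine preimage.\<close>
    have label: "\<nu>\<^sub>2 (?\<sigma> g) = \<nu>\<^sub>1 g" if "g \<in> pverts T\<^sub>1" for g
      using that eq by (metis comp_apply f_inv_into_f imageI)
    \<comment> \<open>Corresponding vertices carry equal labels, so both arc conditions become the
      same relation between labels.\<close>
    have "(g, h) \<in> parcs T\<^sub>1 \<longleftrightarrow> (?\<sigma> g, ?\<sigma> h) \<in> parcs T\<^sub>2"
      if "g \<in> pverts T\<^sub>1" "h \<in> pverts T\<^sub>1" for g h
      using A.arc_iff_direct_subfactorization[OF assms(1,2) that]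
        B.arc_iff_direct_subfactorization[OF assms(1,2), of "?\<sigma> g" "?\<sigma> h"]
      by (simp only: label that bij_betw_apply[OF bij])
    with bij label show ?thesis
      by (simp add: tree_isomorphism_def)
  qed
  have "\<nu>\<^sub>1 ` pverts T\<^sub>1 = \<nu>\<^sub>2 ` pverts T\<^sub>2" if "tree_isomorphic T\<^sub>1 \<nu>\<^sub>1 T\<^sub>2 \<nu>\<^sub>2"
  proof -
    from that obtain \<sigma> where "\<sigma> ` pverts T\<^sub>1 = pverts T\<^sub>2" "\<forall>g\<in>pverts T\<^sub>1. \<nu>\<^sub>2 (\<sigma> g) = \<nu>\<^sub>1 g"
      by (auto simp: tree_isomorphic_def tree_isomorphism_def bij_betw_def)
    then show ?thesis
      by (metis image_cong image_image)
  qed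
  with iso inj2 show ?thesis
    by (auto simp: tree_isomorphic_def)
qed

end
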